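(* Let $G$ be a simple graph with $n$ vertices and $m\geq 1$ edges, and let $S(G)$ be its subdivision graph (obtained by inserting a new vertex of degree two on each edge of $G$), which has $n+m$ vertices and $2m$ edges. Then $$\frac{M_1(S(G))}{n+m}\leq \frac{M_2(S(G))}{2m},$$ with equality if and only if $G$ is regular. Here for a graph $H$, $M_1(H)=\sum_{v\in V(H)} d_v^2$ and $M_2(H)=\sum_{uv\in E(H)} d_u d_v$, with $d_v$ the degree of $v$ in $H$.
   Context: $M_1$ and $M_2$ are the first and second Zagreb indices; in $M_2$ each edge is counted once. *)

theory Defs
  imports Complex_Main
begin

record 'a ugraph =
  verts :: "'a set"
  edges :: "'a set set"

definition simple_graph :: "'a ugraph \<Rightarrow> bool" where
  "simple_graph G \<longleftrightarrow>
     finite (verts G) \<and> (\<forall>e\<in>edges G. e \<subseteq> verts G \<and> card e = 2)"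

definition degree :: "'a ugraph \<Rightarrow> 'a \<Rightarrow> nat" where
  "degree G v = card {e \<in> edges G. v \<in> e}"

definition regular :: "'a ugraph \<Rightarrow> bool" where
  "regular G \<longleftrightarrow> (\<exists>k. \<forall>v\<in>verts G. degree G v = k)"

definition zagreb1 :: "'a ugraph \<Rightarrow> nat" where
  "zagreb1 G = (\<Sum>v\<in>verts G. (degree G v)\<^sup>2)"

(* An edge is an unordered pair {u, v} with u and v distinct, so the inner product is
   d_u * d_v and every edge contributes exactly once. *)
definition zagreb2 :: "'a ugraph \<Rightarrow> nat" where
  "zagreb2 G = (\<Sum>e\<in>edges G. \<Prod>v\<in>e. degree G v)"

(* Inl v is the original vertex v; Inr e is the new vertex inserted on the edge e. *)
definition subdivision :: "'a ugraph \<Rightarrow> ('a + 'a set) ugraph" where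
  "subdivision G =
     \<lparr>verts = Inl ` verts G \<union> Inr ` edges G,
      edges = {{Inl v, Inr e} | v e. e \<in> edges G \<and> v \<in> e}\<rparr>"

lemma zagreb2_summand:
  "u \<noteq> v \<Longrightarrow> (\<Prod>w\<in>{u, v}. degree G w) = degree G u * degree G v"
  by simp

lemma finite_edges: "simple_graph G \<Longrightarrow> finite (edges G)"
  unfolding simple_graph_def by (rule finite_subset[of _ "Pow (verts G)"]) auto

lemma simple_graph_subdivision:
  assumes "simple_graph G"
  shows "simple_graph (subdivision G)"
  using assms finite_edges[OF assms]
  by (auto simp: simple_graph_def subdivision_def)

lemma degree_subdivision_new:
  assumes "simple_graph G" and "e \<in> edges G"
  shows "degree (subdivision G) (Inr e) = 2"
proof -
  have "{d \<in> edges (subdivision G). Inr e \<in> d} = (\<lambda>v. {Inl v, Inr e}) ` e"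
    using assms(2) by (auto simp: subdivision_def)
  moreover have "inj_on (\<lambda>v. {Inl v, Inr e}) e"
    by (auto simp: inj_on_def doubleton_eq_iff)
  ultimately show ?thesis
    using assms by (simp add: degree_def card_image simple_graph_def)
qed

end

(* Writing F for the sum of the squared degrees of G, the subdivision graph has
   M_1 = F + 4m and M_2 = 2F, so the inequality reduces to 4m^2 <= nF. Since the degrees
   sum to 2m, the sum of (n d_v - 2m)^2 over all vertices v equals n (nF - 4m^2). Hence
   nF - 4m^2 is nonnegative, and it vanishes iff all degrees equal 2m/n. *)

theory Submission
  imports Defs
begin

text \<open>Double counting of the incident pairs (v, e): each vertex v lies on
  \<open>degree G v\<close> edges. A constant weight gives the handshake identity, and a weight
  proportional to the degree gives M_2 of the subdivision.\<close>

lemma sum_incidences: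
  fixes f :: "'a \<Rightarrow> 'b::comm_semiring_1"
  assumes "simple_graph G"
  shows "(\<Sum>e\<in>edges G. \<Sum>v\<in>e. f v) = (\<Sum>v\<in>verts G. of_nat (degree G v) * f v)"
proof -
  have fin: "finite (verts G)" and sub: "\<And>e. e \<in> edges G \<Longrightarrow> e \<subseteq> verts G"
    using assms by (auto simp: simple_graph_def)
  \<comment> \<open>Each edge is rewritten as a restriction of \<open>verts G\<close>, so that both
    index sets become independent of each other and the sums can be swapped.\<close>
  have "(\<Sum>e\<in>edges G. \<Sum>v\<in>e. f v) = (\<Sum>e\<in>edges G. \<Sum>v | v \<in> verts G \<and> v \<in> e. f v)"
    using sub by (intro sum.cong refl) (auto intro!: sum.cong)
  also have "\<dots> = (\<Sum>v\<in>verts G. \<Sum>e | e \<in> edges G \<and> v \<in> e. f v)"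
    by (rule sum.swap_restrict) (use fin finite_edges[OF assms] in auto)
  finally show ?thesis by (simp add: degree_def)
qed

lemma handshake:
  assumes "simple_graph G"
  shows "(\<Sum>v\<in>verts G. degree G v) = 2 * card (edges G)"
proof -
  have "(\<Sum>e\<in>edges G. \<Sum>v\<in>e. (1::nat)) = (\<Sum>e\<in>edges G. 2)"
    using assms by (intro sum.cong) (auto simp: simple_graph_def)
  then show ?thesis
    using sum_incidences[OF assms, of "\<lambda>_. 1::nat"] by simp
qed

lemma degree_subdivision_old: "degree (subdivision G) (Inl v) = degree G v"
proof -
  have "{d \<in> edges (subdivision G). Inl v \<in> d}
      = (\<lambda>e. {Inl v, Inr e}) ` {e \<in> edges G. v \<in> e}"
    by (auto simp: subdivision_def)
  moreover have "inj_on (\<lambda>e. {Inl v, Inr e}) {e \<in> edges G. v \<in> e}"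
    by (auto simp: inj_on_def doubleton_eq_iff)
  ultimately show ?thesis
    by (simp add: degree_def card_image)
qed

lemma sum_verts_subdivision:
  fixes f :: "'a + 'a set \<Rightarrow> nat"
  assumes "simple_graph G"
  shows "sum f (verts (subdivision G)) = (\<Sum>v\<in>verts G. f (Inl v)) + (\<Sum>e\<in>edges G. f (Inr e))"
proof -
  have "sum f (verts (subdivision G)) = sum f (Inl ` verts G) + sum f (Inr ` edges G)"
    using assms finite_edges[OF assms] unfolding subdivision_def ugraph.simps
    by (intro sum.union_disjoint) (auto simp: simple_graph_def)
  then show ?thesis by (simp add: sum.reindex)
qed

text \<open>The edges of the subdivision are in bijection with the incident pairs (e, v) of G: the
  tags \<open>Inl\<close> and \<open>Inr\<close> let the unordered pair recover both e and
  v.\<close>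

lemma sum_edges_subdivision:
  fixes f :: "('a + 'a set) set \<Rightarrow> nat"
  assumes "simple_graph G"
  shows "sum f (edges (subdivision G)) = (\<Sum>e\<in>edges G. \<Sum>v\<in>e. f {Inl v, Inr e})"
proof -
  let ?h = "\<lambda>(e, v). {Inl v, Inr e} :: ('a + 'a set) set"
  have "edges (subdivision G) = ?h ` (SIGMA e:edges G. e)"
    by (auto simp: subdivision_def)
  moreover have "inj_on ?h (SIGMA e:edges G. e)"
    by (auto simp: inj_on_def doubleton_eq_iff)
  ultimately have "sum f (edges (subdivision G)) = (\<Sum>(e, v)\<in>(SIGMA e:edges G. e). f {Inl v, Inr e})"
    by (simp add: sum.reindex case_prod_unfold)
  also have "\<dots> = (\<Sum>e\<in>edges G. \<Sum>v\<in>e. f {Inl v, Inr e})"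
    using assms by (intro sum.Sigma[symmetric] finite_edges)
      (auto simp: simple_graph_def intro: finite_subset)
  finally show ?thesis .
qed

lemma card_verts_subdivision:
  "simple_graph G \<Longrightarrow> card (verts (subdivision G)) = card (verts G) + card (edges G)"
  using sum_verts_subdivision[of G "\<lambda>_. 1"] by simp

lemma card_edges_subdivision:
  assumes "simple_graph G"
  shows "card (edges (subdivision G)) = 2 * card (edges G)"
  using sum_edges_subdivision[OF assms, of "\<lambda>_. 1"] handshake[OF assms]
    sum_incidences[OF assms, of "\<lambda>_. 1::nat"] by simp

lemma zagreb1_subdivision:
  assumes "simple_graph G"
  shows "zagreb1 (subdivision G) = zagreb1 G + 4 * card (edges G)"
  using assms
  by (simp add: zagreb1_def sum_verts_subdivision degree_subdivision_old degree_subdivision_new)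

text \<open>An edge joining v to a new vertex contributes 2 d_v, and v is the old end of d_v such
  edges, so v accounts for 2 d_v^2 in total.\<close>

lemma zagreb2_subdivision:
  assumes "simple_graph G"
  shows "zagreb2 (subdivision G) = 2 * zagreb1 G"
proof -
  have "zagreb2 (subdivision G) = (\<Sum>e\<in>edges G. \<Sum>v\<in>e. degree G v * 2)"
    unfolding zagreb2_def sum_edges_subdivision[OF assms]
    using assms by (intro sum.cong refl)
      (simp add: degree_subdivision_old degree_subdivision_new)
  also have "\<dots> = 2 * zagreb1 G"
    unfolding sum_incidences[OF assms]
    by (simp add: zagreb1_def sum_distrib_left power2_eq_square mult_ac)
  finally show ?thesis .
qed

text \<open>This is the variance of the degrees about their mean 2m/n, with each deviation
  multiplied by n so that no division occurs.\<close>

lemma sum_square_degree_deviation: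
  fixes G :: "'a ugraph"
  assumes "simple_graph G"
  defines "n \<equiv> real (card (verts G))" and "m \<equiv> real (card (edges G))"
  shows "(\<Sum>v\<in>verts G. (n * degree G v - 2 * m)\<^sup>2) = n * (n * zagreb1 G - 4 * m\<^sup>2)"
proof -
  have deg: "(\<Sum>v\<in>verts G. real (degree G v)) = 2 * m"
    using arg_cong[OF handshake[OF assms(1)], of real] by (simp add: m_def)
  have "(\<Sum>v\<in>verts G. (n * degree G v - 2 * m)\<^sup>2)
      = (\<Sum>v\<in>verts G. n\<^sup>2 * (degree G v)\<^sup>2 - 4 * m * n * degree G v + 4 * m\<^sup>2)"
    by (intro sum.cong refl) (simp add: power2_eq_square algebra_simps)
  also have "\<dots> = n\<^sup>2 * zagreb1 G - 4 * m * n * (2 * m) + n * (4 * m\<^sup>2)"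
    \<comment> \<open>The factor \<open>2 * m\<close> was left unmultiplied in the middle term so
      that this rewriting turns it back into the degree sum.\<close>
    unfolding deg[symmetric]
    by (simp add: sum.distrib sum_subtractf sum_distrib_left zagreb1_def n_def)
  also have "\<dots> = n * (n * zagreb1 G - 4 * m\<^sup>2)"
    by (simp add: power2_eq_square algebra_simps)
  finally show ?thesis .
qed

text \<open>The mean degree 2m/n need not be an integer, so "every degree equals the mean" is put in
  product form over the naturals.\<close>

lemma regular_iff_degree_eq_average:
  assumes "simple_graph G" and "verts G \<noteq> {}"
  shows "regular G \<longleftrightarrow> (\<forall>v\<in>verts G. card (verts G) * degree G v = 2 * card (edges G))"
proof
  assume "regular G"
  then obtain k where "\<forall>v\<in>verts G. degree G v = k"
    by (auto simp: regular_def)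
  then show "\<forall>v\<in>verts G. card (verts G) * degree G v = 2 * card (edges G)"
    using handshake[OF assms(1)] by simp
next
  assume avg: "\<forall>v\<in>verts G. card (verts G) * degree G v = 2 * card (edges G)"
  have "card (verts G) > 0"
    using assms by (auto simp: simple_graph_def card_gt_0_iff)
  \<comment> \<open>The common degree is this quotient; the division is exact because 2m is n times
    a degree.\<close>
  with avg have "\<forall>v\<in>verts G. degree G v = 2 * card (edges G) div card (verts G)"
    by (metis nonzero_mult_div_cancel_left less_irrefl)
  then show "regular G" unfolding regular_def by blast
qed

text \<open>This is the Cauchy-Schwarz inequality for the degree sequence against the constant
  sequence 1, with its equality case; the sum of the degrees is 2m.\<close>

lemma zagreb1_ge_average:
  assumes "simple_graph G" and "verts G \<noteq> {}"
  defines "n \<equiv> real (card (verts G))" and "m \<equiv> real (card (edges G))"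
  shows "4 * m\<^sup>2 \<le> n * zagreb1 G" and "4 * m\<^sup>2 = n * zagreb1 G \<longleftrightarrow> regular G"
proof -
  have fin: "finite (verts G)"
    using assms(1) by (simp add: simple_graph_def)
  then have n: "n > 0"
    using assms(2) by (simp add: n_def card_gt_0_iff)
  note sq = sum_square_degree_deviation[OF assms(1), folded n_def m_def]
  have "0 \<le> n * (n * zagreb1 G - 4 * m\<^sup>2)"
    unfolding sq[symmetric] by (intro sum_nonneg) simp
  with n show "4 * m\<^sup>2 \<le> n * zagreb1 G"
    by (simp add: zero_le_mult_iff)
  have "4 * m\<^sup>2 = n * zagreb1 G \<longleftrightarrow> n * (n * zagreb1 G - 4 * m\<^sup>2) = 0"
    using n by auto
  also have "\<dots> \<longleftrightarrow> (\<forall>v\<in>verts G. n * degree G v = 2 * m)"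
    unfolding sq[symmetric] using fin by (subst sum_nonneg_eq_0_iff) auto
  also have "\<dots> \<longleftrightarrow> (\<forall>v\<in>verts G. card (verts G) * degree G v = 2 * card (edges G))"
  proof (intro ball_cong refl)
    fix v
    show "n * degree G v = 2 * m \<longleftrightarrow> card (verts G) * degree G v = 2 * card (edges G)"
      using of_nat_eq_iff[of "card (verts G) * degree G v" "2 * card (edges G)", where 'a=real]
      unfolding n_def m_def of_nat_mult of_nat_numeral .
  qed
  finally show "4 * m\<^sup>2 = n * zagreb1 G \<longleftrightarrow> regular G"
    using regular_iff_degree_eq_average[OF assms(1,2)] by simp
qed

theorem theorem3:
  fixes G :: "'a ugraph" and n m :: nat
  assumes "simple_graph G"
    and "card (verts G) = n"
    and "card (edges G) = m"
    and "m \<ge> 1"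
  shows "card (verts (subdivision G)) = n + m
    \<and> card (edges (subdivision G)) = 2 * m
    \<and> real (zagreb1 (subdivision G)) / real (n + m)
        \<le> real (zagreb2 (subdivision G)) / real (2 * m)
    \<and> (real (zagreb1 (subdivision G)) / real (n + m)
        = real (zagreb2 (subdivision G)) / real (2 * m)
       \<longleftrightarrow> regular G)"
proof -
  let ?l = "real (zagreb1 (subdivision G)) / real (n + m)"
  let ?r = "real (zagreb2 (subdivision G)) / real (2 * m)"
  \<comment> \<open>An edge has two ends, so \<open>m \<ge> 1\<close> forces G to have
    vertices.\<close>
  have ne: "verts G \<noteq> {}"
  proof
    assume "verts G = {}"
    then have "\<not> (\<exists>e. e \<in> edges G)"
      using assms(1) by (fastforce simp: simple_graph_def)
    then have "edges G = {}" by blast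
    with assms(3,4) show False by simp
  qed
  note avg = zagreb1_ge_average[OF assms(1) ne, unfolded assms(2,3)]
  have m: "real m > 0" using assms(4) by simp
  \<comment> \<open>With F = \<open>zagreb1 G\<close>, the right side is F/m and the left is (F +
    4m)/(n + m). Over the common denominator the terms mF cancel, leaving nF - 4m^2.\<close>
  have diff: "?r - ?l = (n * zagreb1 G - 4 * (real m)\<^sup>2) / (real m * real (n + m))"
    using m assms(3)
    by (simp add: zagreb1_subdivision[OF assms(1)] zagreb2_subdivision[OF assms(1)]
        divide_simps add_pos_nonneg add_nonneg_pos) (simp add: power2_eq_square algebra_simps)
  have pos: "real m * real (n + m) > 0" using m by simp
  have "0 \<le> ?r - ?l"
    unfolding diff using avg(1) pos by (intro divide_nonneg_pos) simp_all
  moreover have "?r - ?l = 0 \<longleftrightarrow> regular G"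
    unfolding diff avg(2)[symmetric] using pos by auto
  moreover have "?l = ?r \<longleftrightarrow> ?r - ?l = 0" by auto
  ultimately show ?thesis
    using card_verts_subdivision[OF assms(1)] card_edges_subdivision[OF assms(1)] assms(2,3)
    by simp
qed

end
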